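(* For each $\alpha\geq0$ let $S_\alpha=\{\mathfrak h^{1/\beta}:\beta>\alpha\}$. Then, for subsets of $\mathbb R$: (i) $\mathsf{HD}(\alpha)=\mathcal D_{\mathbb R}(\overline{S_\alpha})$ for every $\alpha\geq0$; (ii) $\mathsf{HD}(0)=\mathcal D_{\mathbb R}(S_0)=\mathcal M_{\ln}$.
   Context: $\mathbb S$ is the set of all strictly decreasing sequences $s=(s_n)_{n\geq1}$ of positive reals converging to $0$. For $s\in\mathbb S$ and $k\geq1$ let $s^{\times k}=(s_{kn})_{n\geq1}$; for $S\subseteq\mathbb S$ let $\overline S=\{s^{\times k}:s\in S,\ k\geq1\}$. A set $E\subseteq\mathbb R$ is $S$-dominated if for each $s\in S$ there is a sequence $(E_n)_{n\geq1}$ of subsets of $\mathbb R$ that covers $E$ and satisfies $\operatorname{diam}E_n<s_n$ for all $n$; $\mathcal D_{\mathbb R}(S)$ is the family of all $S$-dominated subsets of $\mathbb R$. For $q>0$, $\mathfrak h^q$ is the sequence $\bigl((n+1)^{-q}\bigr)_{n\geq1}$. $\mathcal M_{\ln}=\mathcal D_{\mathbb R}\bigl(\{(\varepsilon^{\ln(n+1)})_{n\geq1}:\varepsilon\in(0,1)\}\bigr)$. $\mathsf{HD}(\alpha)=\{E\subseteq\mathbb R:\dim_{\mathsf H}E\leq\alpha\}$, where $\dim_{\mathsf H}$ denotes Hausdorff dimension. *)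

theory Defs
  imports "HOL-Analysis.Analysis"
begin

section \<open>Sequences\<close>

text \<open>
  A sequence \<open>(s\<^sub>n)\<^sub>n\<^sub>\<ge>\<^sub>1\<close> is a function on the naturals of which only the values
  at \<open>n \<ge> 1\<close> are ever used; the value at \<open>0\<close> is irrelevant.
\<close>

definition null_seqs :: "(nat \<Rightarrow> real) set" where
  "null_seqs = {s. (\<forall>n\<ge>1. s n > 0) \<and> (\<forall>m\<ge>1. \<forall>n>m. s n < s m) \<and> s \<longlonglongrightarrow> 0}"

definition multiple_seq :: "(nat \<Rightarrow> real) \<Rightarrow> nat \<Rightarrow> nat \<Rightarrow> real" where
  "multiple_seq s k = (\<lambda>n. s (k * n))"

definition multiple_closure :: "(nat \<Rightarrow> real) set \<Rightarrow> (nat \<Rightarrow> real) set" where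
  "multiple_closure S = {multiple_seq s k | s k. s \<in> S \<and> k \<ge> 1}"

definition hseq :: "real \<Rightarrow> nat \<Rightarrow> real" where
  "hseq q = (\<lambda>n. (real n + 1) powr (- q))"

definition S_alpha :: "real \<Rightarrow> (nat \<Rightarrow> real) set" where
  "S_alpha \<alpha> = {hseq (1 / \<beta>) | \<beta>. \<beta> > \<alpha>}"

definition ln_seqs :: "(nat \<Rightarrow> real) set" where
  "ln_seqs = {(\<lambda>n. \<epsilon> powr ln (real n + 1)) | \<epsilon>. \<epsilon> \<in> {0<..<1}}"


section \<open>Dominated sets\<close>

text \<open>
  The library's \<^const>\<open>diameter\<close> is a real number and carries no information for
  unbounded sets, whose diameter is infinite; hence the explicit boundedness conditions,
  here and in the definition of the Hausdorff measure.
\<close>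

definition dominated :: "(nat \<Rightarrow> real) set \<Rightarrow> real set \<Rightarrow> bool" where
  "dominated S E \<longleftrightarrow>
     (\<forall>s\<in>S. \<exists>A :: nat \<Rightarrow> real set.
        E \<subseteq> (\<Union>n\<in>{1..}. A n) \<and> (\<forall>n\<ge>1. bounded (A n) \<and> diameter (A n) < s n))"

definition dominated_sets :: "(nat \<Rightarrow> real) set \<Rightarrow> real set set" where
  "dominated_sets S = {E. dominated S E}"

definition M_ln :: "real set set" where
  "M_ln = dominated_sets ln_seqs"


section \<open>Hausdorff dimension\<close>

text \<open>
  \<open>(diam A)\<^sup>d\<close> with the usual conventions: the empty set contributes \<open>0\<close> for every
  \<open>d\<close>, and a nonempty set contributes \<open>1\<close> for \<open>d = 0\<close> (whereas \<open>0 powr 0 = 0\<close>).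
\<close>

definition diam_pow :: "real \<Rightarrow> 'a::metric_space set \<Rightarrow> ennreal" where
  "diam_pow d A = (if A = {} then 0 else if d = 0 then 1 else ennreal (diameter A powr d))"

definition hausdorff_premeasure :: "real \<Rightarrow> real \<Rightarrow> 'a::metric_space set \<Rightarrow> ennreal" where
  "hausdorff_premeasure d \<delta> E =
     Inf {(\<Sum>n. diam_pow d (A n)) | A :: nat \<Rightarrow> 'a set.
            E \<subseteq> (\<Union>n. A n) \<and> (\<forall>n. bounded (A n) \<and> diameter (A n) \<le> \<delta>)}"

definition hausdorff_measure :: "real \<Rightarrow> 'a::metric_space set \<Rightarrow> ennreal" where
  "hausdorff_measure d E = (SUP \<delta>\<in>{0<..}. hausdorff_premeasure d \<delta> E)"

definition hausdorff_dim :: "'a::metric_space set \<Rightarrow> ennreal" where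
  "hausdorff_dim E = Inf {ennreal d | d. d \<ge> 0 \<and> hausdorff_measure d E = 0}"

definition HD :: "real \<Rightarrow> real set set" where
  "HD \<alpha> = {E. hausdorff_dim E \<le> ennreal \<alpha>}"


section \<open>The sequences above tend strictly monotonically to zero\<close>

lemma hseq_in_null_seqs:
  assumes "q > 0"
  shows "hseq q \<in> null_seqs"
proof -
  have "filterlim (\<lambda>n. real n + 1) at_top sequentially"
    using filterlim_compose[OF filterlim_real_sequentially filterlim_Suc] by (simp add: add.commute)
  then have "(\<lambda>n. (real n + 1) powr (- q)) \<longlonglongrightarrow> 0"
    using assms by (intro tendsto_neg_powr) auto
  moreover have "(real n + 1) powr (- q) < (real m + 1) powr (- q)" if "m < n" for m n
    using assms that by (intro powr_less_mono2_neg) auto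
  ultimately show ?thesis
    by (auto simp: null_seqs_def hseq_def)
qed

lemma S_alpha_subset_null_seqs: "\<alpha> \<ge> 0 \<Longrightarrow> S_alpha \<alpha> \<subseteq> null_seqs"
  by (auto simp: S_alpha_def intro!: hseq_in_null_seqs)

lemma ln_seqs_subset_null_seqs: "ln_seqs \<subseteq> null_seqs"
proof
  fix s assume "s \<in> ln_seqs"
  then obtain \<epsilon> :: real where \<epsilon>: "0 < \<epsilon>" "\<epsilon> < 1" "s = (\<lambda>n. \<epsilon> powr ln (real n + 1))"
    by (auto simp: ln_seqs_def)
  have "s = hseq (- ln \<epsilon>)"
    using \<epsilon> by (auto simp: hseq_def powr_def mult.commute)
  then show "s \<in> null_seqs"
    using \<epsilon> by (auto intro!: hseq_in_null_seqs)
qed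

lemma multiple_closure_subset_null_seqs:
  assumes "S \<subseteq> null_seqs"
  shows "multiple_closure S \<subseteq> null_seqs"
proof
  fix t assume "t \<in> multiple_closure S"
  then obtain s k where t: "s \<in> S" "k \<ge> 1" "t = (\<lambda>n. s (k * n))"
    by (auto simp: multiple_closure_def multiple_seq_def)
  then have s: "\<forall>n\<ge>1. s n > 0" "\<forall>m\<ge>1. \<forall>n>m. s n < s m" "s \<longlonglongrightarrow> 0"
    using assms by (auto simp: null_seqs_def)
  have "strict_mono (\<lambda>n. k * n)"
    using t(2) by (auto simp: strict_mono_def)
  then have "t \<longlonglongrightarrow> 0"
    using LIMSEQ_subseq_LIMSEQ[OF s(3)] t(3) by (simp add: o_def)
  then show "t \<in> null_seqs"
    using s t by (auto simp: null_seqs_def Suc_le_eq)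
qed

end

theory Submission
  imports Defs
begin

text \<open>
  Both the Hausdorff dimension and domination by a set of sequences speak about countable covers;
  the former bounds the sum of powers of the diameters, the latter bounds the diameters one by one.
  The two kinds of bounds are related as follows.

  If \<open>E\<close> has dimension less than \<open>\<beta>\<close>, it has covers for which the sum of the terms
  \<open>diam\<^sup>\<beta>\<close> is as small as desired.  A positive series with sum at most \<open>c\<close>, arranged in
  decreasing order, has an \<open>m\<close>-th term of at most \<open>c / m\<close>
  (\<open>summable_pos_decreasing_rank\<close>), and this is below \<open>1 / (k m + 1)\<close> once \<open>c (k + 1) < 1\<close>.
  Hence the sorted cover has \<open>m\<close>-th diameter below \<open>(k m + 1) powr (- 1 / \<beta>)\<close>, which is the
  \<open>m\<close>-th term of the \<open>k\<close>-th multiple of \<open>hseq (1 / \<beta>)\<close>.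

  Conversely, a cover with diameters below the latter sequence has, for every \<open>\<gamma> > \<beta>\<close>, a sum of
  \<open>\<gamma>\<close>-th powers of at most \<open>k powr (- \<gamma> / \<beta>)\<close> times the convergent series of the terms
  \<open>n powr (- \<gamma> / \<beta>)\<close>.  Letting \<open>k\<close> grow makes both this bound and the mesh of the cover tend to
  zero, so that the \<open>\<gamma>\<close>-dimensional measure vanishes.  The multiples are what makes the bound
  arbitrarily small.  As \<open>\<beta>\<close> and \<open>\<gamma>\<close> may be chosen arbitrarily close to \<open>\<alpha>\<close>, the dimension is at
  most \<open>\<alpha>\<close>.

  Each multiple of a sequence in \<open>S_alpha 0\<close> lies above another such sequence:
  \<open>k n + 1 \<le> (n + 1) ^ k\<close> by Bernoulli's inequality, so that
  \<open>hseq (k q)\<close> lies below the \<open>k\<close>-th multiple of \<open>hseq q\<close>, and all positive exponents occur.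
  Finally, \<open>\<epsilon> powr ln (n + 1) = (n + 1) powr ln \<epsilon>\<close>, so that the sequences defining \<open>M_ln\<close> are
  exactly those in \<open>S_alpha 0\<close>.
\<close>

section \<open>Decreasing rearrangement of a positive series\<close>

text \<open>
  The rank of an index is its position when the terms are sorted decreasingly, ties being broken
  by the index.  The terms up to rank \<open>\<pi> n\<close> are all at least \<open>b n\<close>, so that
  \<open>\<pi> n * b n\<close> is at most their sum.
\<close>

lemma summable_pos_decreasing_rank:
  fixes b :: "nat \<Rightarrow> real"
  assumes pos: "\<And>n. b n > 0" and sum: "summable b"
  obtains \<pi> :: "nat \<Rightarrow> nat"
  where "inj \<pi>" "\<And>n. \<pi> n \<ge> 1" "\<And>n. real (\<pi> n) * b n \<le> suminf b"
proof -
  define R where "R n = {m. b m > b n \<or> (b m = b n \<and> m \<le> n)}" for n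
  have fin: "finite (R n)" for n
  proof -
    have "eventually (\<lambda>m. b m < b n) sequentially"
      using order_tendstoD(2)[OF summable_LIMSEQ_zero[OF sum] pos] .
    then obtain N where N: "\<And>m. m \<ge> N \<Longrightarrow> b m < b n"
      by (auto simp: eventually_sequentially)
    have "R n \<subseteq> {..<N}"
      using N by (force simp: R_def not_less[symmetric])
    then show ?thesis
      by (rule finite_subset) simp
  qed
  have self: "n \<in> R n" for n
    by (simp add: R_def)
  have neq: "card (R m) \<noteq> card (R n)" if "m \<noteq> n" for m n
  proof -
    have "R m \<subset> R n \<or> R n \<subset> R m"
    proof (cases "b m > b n \<or> (b m = b n \<and> m < n)")
      case True
      then have "R m \<subseteq> R n" "n \<notin> R m"
        by (auto simp: R_def)
      with self[of n] show ?thesis by blast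
    next
      case False
      with that have "R n \<subseteq> R m" "m \<notin> R n"
        by (auto simp: R_def)
      with self[of m] show ?thesis by blast
    qed
    then show ?thesis
      using psubset_card_mono[OF fin] by (metis less_irrefl)
  qed
  show thesis
  proof
    show "inj (\<lambda>n. card (R n))"
      using neq by (auto simp: inj_def)
    show "card (R n) \<ge> 1" for n
      using self[of n] fin[of n] by (auto simp: Suc_le_eq card_gt_0_iff)
    show "real (card (R n)) * b n \<le> suminf b" for n
    proof -
      have "real (card (R n)) * b n \<le> sum b (R n)"
        by (rule sum_bounded_below) (auto simp: R_def)
      also have "\<dots> \<le> suminf b"
        using pos by (intro sum_le_suminf sum fin) (auto intro: less_imp_le)
      finally show ?thesis .
    qed
  qed
qed

section \<open>From small dimension to domination\<close>

text \<open>
  Diameters are at most \<open>1\<close> here, so that raising the exponent only decreases the powers.  Allowing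
  \<open>d \<le> \<beta>\<close> spares a proof that \<open>hausdorff_measure\<close> is monotone in the exponent, and also
  covers the convention for \<open>d = 0\<close>.
\<close>

lemma diam_pow_ge_powr:
  assumes "0 \<le> d" "d \<le> \<beta>" "0 < \<beta>" "bounded A" "diameter A \<le> 1"
  shows "ennreal (diameter A powr \<beta>) \<le> diam_pow d A"
proof (cases "A = {} \<or> d = 0")
  case True
  have "diameter A powr \<beta> \<le> 1 powr \<beta>"
    using assms by (intro powr_mono2 diameter_ge_0) auto
  with True assms(3) show ?thesis
    by (auto simp: diam_pow_def ennreal_le_1)
next
  case False
  have "diameter A powr \<beta> \<le> diameter A powr d"
    using assms diameter_ge_0[OF assms(4)] by (intro powr_mono') auto
  with False show ?thesis
    by (auto simp: diam_pow_def intro: ennreal_leI)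
qed

lemma hausdorff_measure_0_cover:
  assumes null: "hausdorff_measure d E = 0"
    and d: "0 \<le> d" "d \<le> \<beta>" "0 < \<beta>" and c: "c > 0"
  obtains A :: "nat \<Rightarrow> 'a::metric_space set"
  where "E \<subseteq> (\<Union>n. A n)" "\<And>n. bounded (A n)"
    "summable (\<lambda>n. diameter (A n) powr \<beta>)" "(\<Sum>n. diameter (A n) powr \<beta>) < c"
proof -
  have "hausdorff_premeasure d 1 E \<le> hausdorff_measure d E"
    unfolding hausdorff_measure_def by (rule SUP_upper) simp
  also have "\<dots> < ennreal c"
    using null c by simp
  finally obtain A :: "nat \<Rightarrow> 'a set"
    where A: "E \<subseteq> (\<Union>n. A n)" "\<And>n. bounded (A n)" "\<And>n. diameter (A n) \<le> 1"
      and less: "(\<Sum>n. diam_pow d (A n)) < ennreal c"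
    unfolding hausdorff_premeasure_def Inf_less_iff by blast
  have "(\<Sum>n. ennreal (diameter (A n) powr \<beta>)) \<le> (\<Sum>n. diam_pow d (A n))"
    using A d by (intro suminf_le diam_pow_ge_powr) auto
  with less have lt: "(\<Sum>n. ennreal (diameter (A n) powr \<beta>)) < ennreal c"
    by simp
  then have summ: "summable (\<lambda>n. diameter (A n) powr \<beta>)"
    by (intro summable_suminf_not_top) auto
  have "ennreal (\<Sum>n. diameter (A n) powr \<beta>) = (\<Sum>n. ennreal (diameter (A n) powr \<beta>))"
    using summ by (intro suminf_ennreal2[symmetric]) auto
  with lt have "ennreal (\<Sum>n. diameter (A n) powr \<beta>) < ennreal c"
    by simp
  moreover have "(\<Sum>n. diameter (A n) powr \<beta>) \<ge> 0"
    by (intro suminf_nonneg summ) simp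
  ultimately have "(\<Sum>n. diameter (A n) powr \<beta>) < c"
    by (simp only: ennreal_less_iff)
  with A summ show thesis
    by (intro that) auto
qed

text \<open>
  Domination allows one set per index \<open>n \<ge> 1\<close>, but a cover may be distributed
  injectively over these indices: the unused ones receive the empty set.
\<close>

lemma dominating_cover_reindex:
  fixes A :: "nat \<Rightarrow> real set"
  assumes "E \<subseteq> (\<Union>n. A n)" "\<And>n. bounded (A n)"
    and \<pi>: "inj \<pi>" "\<And>n. \<pi> n \<ge> (1::nat)"
    and less: "\<And>n. diameter (A n) < s (\<pi> n)" and pos: "\<And>n. n \<ge> 1 \<Longrightarrow> s n > 0"
  shows "\<exists>B. E \<subseteq> (\<Union>n\<in>{1..}. B n) \<and> (\<forall>n\<ge>1. bounded (B n) \<and> diameter (B n) < s n)"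
proof (intro exI conjI allI impI)
  define B where "B m = (if m \<in> range \<pi> then A (inv \<pi> m) else {})" for m
  have B: "B (\<pi> n) = A n" for n
    using \<pi>(1) by (simp add: B_def)
  show "E \<subseteq> (\<Union>n\<in>{1..}. B n)"
    using assms(1) B \<pi>(2) by fastforce
  fix m :: nat assume m: "m \<ge> 1"
  show "bounded (B m)"
    using assms(2) by (simp add: B_def)
  show "diameter (B m) < s m"
  proof (cases "m \<in> range \<pi>")
    case True
    then show ?thesis using B less by auto
  next
    case False
    then show ?thesis using pos[OF m] by (simp add: B_def)
  qed
qed

text \<open>
  The rank lemma needs positive terms, and the diameters must be strictly smaller than required;
  a geometric series of total \<open>c / 2\<close> is added to the powers of the diameters for this purpose.
\<close>

lemma dominated_if_hausdorff_dim_less: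
  fixes E :: "real set"
  assumes dim: "hausdorff_dim E < ennreal \<beta>" and k: "k \<ge> 1"
  shows "\<exists>B. E \<subseteq> (\<Union>n\<in>{1..}. B n) \<and>
    (\<forall>n\<ge>1. bounded (B n) \<and> diameter (B n) < multiple_seq (hseq (1 / \<beta>)) k n)"
proof -
  obtain d where d: "d \<ge> 0" "hausdorff_measure d E = 0" "ennreal d < ennreal \<beta>"
    using dim unfolding hausdorff_dim_def Inf_less_iff by auto
  then have "d < \<beta>"
    by (simp add: ennreal_less_iff)
  with d(1) have \<beta>: "\<beta> > 0" "d \<le> \<beta>" by auto
  define c :: real where "c = 1 / (real k + 2)"
  have c: "c > 0"
    by (simp add: c_def)
  then have "c / 2 > 0" by simp
  then obtain A :: "nat \<Rightarrow> real set"
    where A: "E \<subseteq> (\<Union>n. A n)" "\<And>n. bounded (A n)"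
      and summ: "summable (\<lambda>n. diameter (A n) powr \<beta>)"
      and sum_less: "(\<Sum>n. diameter (A n) powr \<beta>) < c / 2"
    using hausdorff_measure_0_cover[OF d(2) d(1) \<beta>(2) \<beta>(1)] by metis
  define b where "b n = diameter (A n) powr \<beta> + c / 2 * (1 / 2) ^ Suc n" for n
  have geom: "(\<lambda>n. c / 2 * (1 / 2) ^ Suc n) sums (c / 2 * 1)"
    by (intro sums_mult power_half_series)
  have "b sums ((\<Sum>n. diameter (A n) powr \<beta>) + c / 2 * 1)"
    unfolding b_def by (intro sums_add summable_sums summ geom)
  then have b: "summable b" "suminf b \<le> c"
    using sum_less by (auto simp: sums_iff)
  have b_pos: "b n > 0" for n
    unfolding b_def using c by (intro add_nonneg_pos) auto
  obtain \<pi> where \<pi>: "inj \<pi>" "\<And>n. \<pi> n \<ge> 1" "\<And>n. real (\<pi> n) * b n \<le> suminf b"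
    using summable_pos_decreasing_rank[OF b_pos b(1)] by metis
  have less: "diameter (A n) < multiple_seq (hseq (1 / \<beta>)) k (\<pi> n)" for n
  proof -
    have "real (\<pi> n) \<ge> 1"
      using \<pi>(2)[of n] by linarith
    have "b n \<le> c / real (\<pi> n)"
      using \<pi>(3)[of n] b(2) \<open>real (\<pi> n) \<ge> 1\<close> by (simp add: field_simps)
    also have "\<dots> \<le> 1 / (real k * real (\<pi> n) + 1)"
    proof -
      have "real k * real (\<pi> n) + 1 \<le> (real k + 2) * real (\<pi> n)"
        using \<open>real (\<pi> n) \<ge> 1\<close> by (simp add: distrib_right)
      then have "1 / ((real k + 2) * real (\<pi> n)) \<le> 1 / (real k * real (\<pi> n) + 1)"
        by (intro frac_le) (auto intro: add_nonneg_pos)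
      then show ?thesis by (simp add: c_def)
    qed
    finally have le: "b n \<le> 1 / (real k * real (\<pi> n) + 1)" .
    have "diameter (A n) = (diameter (A n) powr \<beta>) powr (1 / \<beta>)"
      using \<beta> diameter_ge_0[OF A(2)] by (simp add: powr_powr)
    also have "\<dots> < b n powr (1 / \<beta>)"
      using \<beta> c by (intro powr_less_mono2) (auto simp: b_def)
    also have "\<dots> \<le> (1 / (real k * real (\<pi> n) + 1)) powr (1 / \<beta>)"
      using \<beta> le b_pos[of n] by (intro powr_mono2) auto
    also have "\<dots> = multiple_seq (hseq (1 / \<beta>)) k (\<pi> n)"
      by (simp add: multiple_seq_def hseq_def powr_divide powr_minus_divide)
    finally show ?thesis .
  qed
  show ?thesis
  proof (rule dominating_cover_reindex[OF A \<pi>(1,2) less])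
    have "real k * real n + 1 > 0" for n
      by (intro add_nonneg_pos) auto
    then show "multiple_seq (hseq (1 / \<beta>)) k n > 0" for n
      by (simp add: multiple_seq_def hseq_def less_imp_neq[THEN not_sym])
  qed
qed

section \<open>From domination to small dimension\<close>

text \<open>
  The covering sets with index \<open>n \<ge> 1\<close> have \<open>\<gamma>\<close>-th powers bounded by \<open>k\<^sup>-\<^sup>p n\<^sup>-\<^sup>p\<close>, where
  \<open>p = \<gamma> / \<beta> > 1\<close>.
\<close>

lemma hausdorff_premeasure_le_of_dominating_cover:
  fixes B :: "nat \<Rightarrow> real set"
  assumes \<beta>: "0 < \<beta>" "\<beta> < \<gamma>" and k: "k \<ge> (1::nat)"
    and cover: "E \<subseteq> (\<Union>n\<in>{1..}. B n)"
    and small: "\<And>n. n \<ge> 1 \<Longrightarrow> bounded (B n) \<and> diameter (B n) < multiple_seq (hseq (1 / \<beta>)) k n"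
    and \<delta>: "real k powr (- 1 / \<beta>) \<le> \<delta>"
  shows "hausdorff_premeasure \<gamma> \<delta> E
    \<le> ennreal (real k powr (- \<gamma> / \<beta>) * (\<Sum>n. real (Suc n) powr (- \<gamma> / \<beta>)))"
proof -
  define A where "A n = B (Suc n)" for n
  have E: "E \<subseteq> (\<Union>n. A n)"
  proof
    fix x assume "x \<in> E"
    with cover obtain n where "n \<ge> 1" "x \<in> B n" by auto
    then have "x \<in> A (n - 1)" by (simp add: A_def)
    then show "x \<in> (\<Union>n. A n)" by blast
  qed
  have bd: "bounded (A n)" for n
    using small by (simp add: A_def)
  have diam: "diameter (A n) \<le> (real k * real (Suc n)) powr (- 1 / \<beta>)" for n
  proof -
    have "diameter (A n) \<le> (real k * real (Suc n) + 1) powr (- 1 / \<beta>)"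
      using small[of "Suc n"] by (simp add: A_def multiple_seq_def hseq_def less_imp_le)
    also have "\<dots> \<le> (real k * real (Suc n)) powr (- 1 / \<beta>)"
      using \<beta> k by (intro powr_mono2') auto
    finally show ?thesis .
  qed
  have mesh: "diameter (A n) \<le> \<delta>" for n
  proof -
    have "real k * 1 \<le> real k * real (Suc n)"
      by (intro mult_left_mono) auto
    then have "(real k * real (Suc n)) powr (- 1 / \<beta>) \<le> real k powr (- 1 / \<beta>)"
      using \<beta> k by (intro powr_mono2') auto
    with diam[of n] \<delta> show ?thesis by linarith
  qed
  have pow: "diam_pow \<gamma> (A n)
      \<le> ennreal (real k powr (- \<gamma> / \<beta>) * real (Suc n) powr (- \<gamma> / \<beta>))" for n
  proof -
    have "diameter (A n) powr \<gamma> \<le> ((real k * real (Suc n)) powr (- 1 / \<beta>)) powr \<gamma>"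
      using \<beta> by (intro powr_mono2 diam diameter_ge_0 bd) auto
    also have "\<dots> = real k powr (- \<gamma> / \<beta>) * real (Suc n) powr (- \<gamma> / \<beta>)"
      by (simp add: powr_powr powr_mult del: of_nat_Suc)
    finally show ?thesis
      using \<beta> by (auto simp: diam_pow_def intro: ennreal_leI)
  qed
  have "summable (\<lambda>n. real n powr (- \<gamma> / \<beta>))"
    using \<beta> by (subst summable_real_powr_iff) (simp add: field_simps)
  then have summ: "summable (\<lambda>n. real (Suc n) powr (- \<gamma> / \<beta>))"
    by (subst summable_Suc_iff)
  have "hausdorff_premeasure \<gamma> \<delta> E \<le> (\<Sum>n. diam_pow \<gamma> (A n))"
    unfolding hausdorff_premeasure_def by (rule Inf_lower) (use E bd mesh in blast)
  also have "\<dots> \<le> (\<Sum>n. ennreal (real k powr (- \<gamma> / \<beta>) * real (Suc n) powr (- \<gamma> / \<beta>)))"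
    by (intro suminf_le pow) auto
  also have "\<dots> = ennreal (\<Sum>n. real k powr (- \<gamma> / \<beta>) * real (Suc n) powr (- \<gamma> / \<beta>))"
    using summ by (intro suminf_ennreal2 summable_mult) auto
  also have "\<dots> = ennreal (real k powr (- \<gamma> / \<beta>) * (\<Sum>n. real (Suc n) powr (- \<gamma> / \<beta>)))"
    using summ by (simp only: suminf_mult)
  finally show ?thesis .
qed

text \<open>
  For a fixed mesh, the preceding bound holds for all large \<open>k\<close> and tends to zero.
\<close>

lemma hausdorff_measure_0_if_dominated:
  fixes E :: "real set"
  assumes \<beta>: "0 < \<beta>" "\<beta> < \<gamma>"
    and dom: "dominated (multiple_closure {hseq (1 / \<beta>)}) E"
  shows "hausdorff_measure \<gamma> E = 0"
proof -
  let ?Z = "\<Sum>n. real (Suc n) powr (- \<gamma> / \<beta>)"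
  have "hausdorff_premeasure \<gamma> \<delta> E \<le> 0" if "\<delta> > 0" for \<delta>
  proof (rule tendsto_lowerbound)
    have "(\<lambda>k. real k powr (- \<gamma> / \<beta>)) \<longlonglongrightarrow> 0"
      using \<beta> by (intro tendsto_neg_powr filterlim_real_sequentially) simp
    from tendsto_ennrealI[OF tendsto_mult_left_zero[OF this, of ?Z]]
    show "(\<lambda>k. ennreal (real k powr (- \<gamma> / \<beta>) * ?Z)) \<longlonglongrightarrow> 0"
      by simp
    have "(\<lambda>k. real k powr (- 1 / \<beta>)) \<longlonglongrightarrow> 0"
      using \<beta> by (intro tendsto_neg_powr filterlim_real_sequentially) simp
    from order_tendstoD(2)[OF this that] eventually_ge_at_top[of 1]
    show "\<forall>\<^sub>F k in sequentially.
        hausdorff_premeasure \<gamma> \<delta> E \<le> ennreal (real k powr (- \<gamma> / \<beta>) * ?Z)"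
    proof eventually_elim
      case (elim k)
      then have "multiple_seq (hseq (1 / \<beta>)) k \<in> multiple_closure {hseq (1 / \<beta>)}"
        by (auto simp: multiple_closure_def)
      with dom obtain B :: "nat \<Rightarrow> real set" where "E \<subseteq> (\<Union>n\<in>{1..}. B n)"
        "\<forall>n\<ge>1. bounded (B n) \<and> diameter (B n) < multiple_seq (hseq (1 / \<beta>)) k n"
        unfolding dominated_def by blast
      with elim \<beta> show ?case
        by (intro hausdorff_premeasure_le_of_dominating_cover) auto
    qed
  qed simp
  then have "hausdorff_measure \<gamma> E \<le> 0"
    unfolding hausdorff_measure_def by (intro SUP_least) auto
  then show ?thesis by simp
qed

lemma dominated_antimono: "dominated S E \<Longrightarrow> T \<subseteq> S \<Longrightarrow> dominated T E"
  by (auto simp: dominated_def)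

theorem HD_eq_dominated_sets:
  assumes "\<alpha> \<ge> 0"
  shows "HD \<alpha> = dominated_sets (multiple_closure (S_alpha \<alpha>))"
proof (intro set_eqI iffI)
  fix E assume "E \<in> HD \<alpha>"
  then have "hausdorff_dim E < ennreal \<beta>" if "\<beta> > \<alpha>" for \<beta>
    using that assms by (auto simp: HD_def ennreal_less_iff intro: le_less_trans)
  then show "E \<in> dominated_sets (multiple_closure (S_alpha \<alpha>))"
    using dominated_if_hausdorff_dim_less
    by (fastforce simp: dominated_sets_def dominated_def multiple_closure_def S_alpha_def)
next
  fix E assume "E \<in> dominated_sets (multiple_closure (S_alpha \<alpha>))"
  then have dom: "dominated (multiple_closure (S_alpha \<alpha>)) E"
    by (simp add: dominated_sets_def)
  have "hausdorff_dim E \<le> ennreal \<gamma>" if "\<gamma> > \<alpha>" for \<gamma>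
  proof -
    obtain \<beta> where \<beta>: "\<alpha> < \<beta>" "\<beta> < \<gamma>"
      using dense[OF \<open>\<gamma> > \<alpha>\<close>] by blast
    then have "dominated (multiple_closure {hseq (1 / \<beta>)}) E"
      by (intro dominated_antimono[OF dom]) (auto simp: multiple_closure_def S_alpha_def)
    then have "hausdorff_measure \<gamma> E = 0"
      using \<beta> assms by (intro hausdorff_measure_0_if_dominated) auto
    then show ?thesis
      unfolding hausdorff_dim_def using \<beta> assms by (intro Inf_lower) auto
  qed
  then have "\<forall>\<^sub>F \<gamma> in at_right \<alpha>. hausdorff_dim E \<le> ennreal \<gamma>"
    by (auto simp: eventually_at_right_field intro!: exI[of _ "\<alpha> + 1"])
  moreover have "((\<lambda>\<gamma>. ennreal \<gamma>) \<longlongrightarrow> ennreal \<alpha>) (at_right \<alpha>)"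
    by (intro tendsto_ennrealI tendsto_ident_at)
  ultimately have "hausdorff_dim E \<le> ennreal \<alpha>"
    by (intro tendsto_lowerbound) auto
  then show "E \<in> HD \<alpha>"
    by (simp add: HD_def)
qed

section \<open>Dimension zero\<close>

lemma multiple_seq_hseq_ge:
  assumes "q > 0"
  shows "hseq (real k * q) n \<le> multiple_seq (hseq q) k n"
proof -
  have "1 + real k * real n \<le> (1 + real n) ^ k"
    by (rule Bernoulli_inequality) simp
  then have "((1 + real n) ^ k) powr (- q) \<le> (1 + real k * real n) powr (- q)"
    using assms by (intro powr_mono2') (auto intro: add_pos_nonneg)
  then show ?thesis
    by (simp add: hseq_def multiple_seq_def powr_powr powr_realpow[symmetric] add.commute)
qed

lemma dominated_multiple_closure_S_alpha_0:
  assumes "dominated (S_alpha 0) E"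
  shows "dominated (multiple_closure (S_alpha 0)) E"
  unfolding dominated_def
proof
  fix s assume "s \<in> multiple_closure (S_alpha 0)"
  then obtain \<beta> k where \<beta>: "\<beta> > 0" "k \<ge> 1" and s: "s = multiple_seq (hseq (1 / \<beta>)) k"
    by (auto simp: multiple_closure_def S_alpha_def)
  have "hseq (1 / (\<beta> / real k)) \<in> S_alpha 0"
    using \<beta> unfolding S_alpha_def by fastforce
  then obtain A :: "nat \<Rightarrow> real set" where A: "E \<subseteq> (\<Union>n\<in>{1..}. A n)"
    "\<forall>n\<ge>1. bounded (A n) \<and> diameter (A n) < hseq (1 / (\<beta> / real k)) n"
    using assms unfolding dominated_def by blast
  have "hseq (1 / (\<beta> / real k)) n \<le> s n" for n
    using multiple_seq_hseq_ge[of "1 / \<beta>" k n] \<beta> s by simp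
  with A show "\<exists>A. E \<subseteq> (\<Union>n\<in>{1..}. A n) \<and> (\<forall>n\<ge>1. bounded (A n) \<and> diameter (A n) < s n)"
    by (meson less_le_trans)
qed

lemma subset_multiple_closure: "S \<subseteq> multiple_closure S"
proof
  fix s assume "s \<in> S"
  moreover have "s = multiple_seq s 1"
    by (simp add: multiple_seq_def)
  ultimately show "s \<in> multiple_closure S"
    unfolding multiple_closure_def by blast
qed

text \<open>
  The substitution is \<open>\<epsilon> = exp (- 1 / \<beta>)\<close>.
\<close>

lemma ln_seqs_eq_S_alpha_0: "ln_seqs = S_alpha 0"
proof (intro set_eqI iffI)
  fix s assume "s \<in> ln_seqs"
  then obtain \<epsilon> :: real where \<epsilon>: "0 < \<epsilon>" "\<epsilon> < 1" "s = (\<lambda>n. \<epsilon> powr ln (real n + 1))"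
    by (auto simp: ln_seqs_def)
  then have "s = hseq (1 / (- 1 / ln \<epsilon>))" "- 1 / ln \<epsilon> > 0"
    by (auto simp: hseq_def powr_def mult.commute divide_neg_neg)
  then show "s \<in> S_alpha 0"
    unfolding S_alpha_def by blast
next
  fix s assume "s \<in> S_alpha 0"
  then obtain \<beta> where \<beta>: "\<beta> > 0" "s = hseq (1 / \<beta>)"
    by (auto simp: S_alpha_def)
  then have "s = (\<lambda>n. exp (- 1 / \<beta>) powr ln (real n + 1))" "exp (- 1 / \<beta>) \<in> {0<..<1}"
    by (auto simp: hseq_def powr_def mult.commute)
  then show "s \<in> ln_seqs"
    unfolding ln_seqs_def by blast
qed

theorem proposition7p1:
  shows "(\<forall>\<alpha>::real. \<alpha> \<ge> 0 \<longrightarrow> HD \<alpha> = dominated_sets (multiple_closure (S_alpha \<alpha>)))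
    \<and> (HD 0 = dominated_sets (S_alpha 0) \<and> dominated_sets (S_alpha 0) = M_ln)"
proof -
  have "dominated_sets (multiple_closure (S_alpha 0)) = dominated_sets (S_alpha 0)"
    using dominated_multiple_closure_S_alpha_0 dominated_antimono[OF _ subset_multiple_closure]
    by (auto simp: dominated_sets_def)
  then show ?thesis
    by (simp add: HD_eq_dominated_sets M_ln_def ln_seqs_eq_S_alpha_0)
qed

end
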